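(* Let $\{T_k\}_{k\in\mathbb{N}}$ be the sequence of Read-Bajraktarević operators on $(\mathcal{B}(X,Y),d)$ defined in the context, with $s=\sup_{k\in\mathbb{N}}\max_{1\le i\le n_k}\|S_{i,k}\|_\infty<1$, and suppose that $$\sup_{k\in\mathbb{N}}\ \max_{1\le i\le n_k} d(q_{i,k},0)\le M$$ for some $M>0$. Let $\mathscr{I}=\{g\in\mathcal{B}(X,Y): d(g,0)\le M/(1-s)\}$ be the closed ball of radius $M/(1-s)$ centered at $0$. Then the backward trajectories $\Psi_k:=T_1\circ T_2\circ\cdots\circ T_k$ converge for any initial $f_0\in\mathscr{I}$ to a unique attractor in $\mathscr{I}$: there exists a unique $f^*\in\mathscr{I}$ such that $\lim_{k\to\infty} d(\Psi_k(f_0),f^* )=0$ for every $f_0\in\mathscr{I}$.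
   Context: Let $(X,d_X)$ be a (nonempty) complete metric space. For each $k\in\mathbb{N}$ let $n_k>1$ be an integer and let $l_{1,k},\dots,l_{n_k,k}:X\to X$ be injective contractions (Lipschitz constant $<1$) that partition $X$: $X=\bigcup_{i=1}^{n_k} l_{i,k}(X)$ and $l_{i,k}(X)\cap l_{j,k}(X)=\emptyset$ for $i\ne j$. Let $Y$ be an $F$-space, i.e. a (real) topological vector space whose topology is induced by a complete translation-invariant metric $d_Y$; assume in addition that $d_Y$ is homogeneous: $d_Y(\lambda y,\lambda y')=|\lambda|\,d_Y(y,y')$ for all $\lambda\in\mathbb{R}$, $y,y'\in Y$. A map $g:X\to Y$ is bounded if there is $C>0$ with $d_Y(g(x_1),g(x_2))<C$ for all $x_1,x_2\in X$. $\mathcal{B}(X,Y)$ is the set of bounded maps $X\to Y$ with the complete metric $d(g,h):=\sup_{x\in X}d_Y(g(x),h(x))$; $0$ denotes the zero function. Let $q_{i,k}\in\mathcal{B}(X,Y)$ and $S_{i,k}\in\mathcal{B}(X,\mathbb{R})$ for $k\in\mathbb{N}$, $1\le i\le n_k$, with $s:=\sup_{k\in\mathbb{N}}\max_{1\le i\le n_k}\|S_{i,k}\|_\infty<1$, where $\|\cdot\|_\infty$ is the supremum norm. For each $k\in\mathbb{N}$ the Read-Bajraktarević (RB) operator $T_k:\mathcal{B}(X,Y)\to\mathcal{B}(X,Y)$ is $$T_kf:=\sum_{i=1}^{n_k} (q_{i,k}\circ l_{i,k}^{-1})\,\chi_{l_{i,k}(X)}+\sum_{i=1}^{n_k}(S_{i,k}\circ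 l_{i,k}^{-1})\cdot (f\circ l_{i,k}^{-1})\,\chi_{l_{i,k}(X)},$$ where $\chi_A$ is the characteristic function of $A$; that is, $(T_kf)(l_{i,k}(x))=q_{i,k}(x)+S_{i,k}(x)f(x)$ for $x\in X$, $1\le i\le n_k$. *)

theory Defs
  imports "HOL-Analysis.Analysis"
begin

text \<open>
  A real topological vector space whose topology is induced by a complete
  translation-invariant metric. Homogeneity of the metric is not part of the class.
\<close>

class F_space = real_vector + topological_ab_group_add + complete_space +
  assumes tendsto_scaleR_nhds_Pair:
    "LIM p (nhds c \<times>\<^sub>F nhds y). fst p *\<^sub>R snd p :> nhds (c *\<^sub>R y)"
    and dist_translation_invariant: "dist (x + z) (y + z) = dist x y"

instance banach \<subseteq> F_space
proof
  fix c :: real and y :: 'a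
  have "((\<lambda>p. fst p *\<^sub>R snd p) \<longlongrightarrow> c *\<^sub>R y) (nhds (c, y))"
    by (intro tendsto_scaleR tendsto_fst[of _ "(c, y)", simplified]
        tendsto_snd[of _ "(c, y)", simplified] filterlim_ident)
  then show "LIM p (nhds c \<times>\<^sub>F nhds y). fst p *\<^sub>R snd p :> nhds (c *\<^sub>R y)"
    by (simp add: nhds_prod)
next
  fix x y z :: 'a
  show "dist (x + z) (y + z) = dist x y"
    by (simp add: dist_norm)
qed

definition contraction :: "('a::metric_space \<Rightarrow> 'a) \<Rightarrow> bool" where
  "contraction h \<longleftrightarrow> (\<exists>c<1. c-lipschitz_on UNIV h)"

definition bounded_maps :: "('a \<Rightarrow> 'b::metric_space) set" where
  "bounded_maps = {g. \<exists>C>0. \<forall>x1 x2. dist (g x1) (g x2) < C}"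

text \<open>
  The next two suprema are meant for bounded maps only: the real \<open>SUP\<close> is unspecified
  on sets that are not bounded above.
\<close>

definition sup_dist :: "('a \<Rightarrow> 'b::metric_space) \<Rightarrow> ('a \<Rightarrow> 'b) \<Rightarrow> real" where
  "sup_dist g h = (SUP x. dist (g x) (h x))"

definition sup_norm :: "('a \<Rightarrow> real) \<Rightarrow> real" where
  "sup_norm S = (SUP x. \<bar>S x\<bar>)"

text \<open>
  \<open>inv (l i)\<close> is arbitrary outside \<open>range (l i)\<close>; the indicators remove those values.
\<close>

definition RB_op ::
  "nat \<Rightarrow> (nat \<Rightarrow> 'a \<Rightarrow> 'a) \<Rightarrow> (nat \<Rightarrow> 'a \<Rightarrow> 'b::F_space) \<Rightarrow> (nat \<Rightarrow> 'a \<Rightarrow> real)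
    \<Rightarrow> ('a \<Rightarrow> 'b) \<Rightarrow> 'a \<Rightarrow> 'b" where
  "RB_op n l q S f = (\<lambda>y.
     (\<Sum>i=1..n. indicator (range (l i)) y *\<^sub>R q i (inv (l i) y)) +
     (\<Sum>i=1..n. indicator (range (l i)) y *\<^sub>R (S i (inv (l i) y) *\<^sub>R f (inv (l i) y))))"

text \<open>\<open>backward_traj T k\<close> is \<open>T 1 \<circ> T 2 \<circ> \<dots> \<circ> T k\<close>; the value \<open>T 0\<close> is not used.\<close>

fun backward_traj :: "(nat \<Rightarrow> 'a \<Rightarrow> 'a) \<Rightarrow> nat \<Rightarrow> 'a \<Rightarrow> 'a" where
  "backward_traj T 0 = id"
| "backward_traj T (Suc k) = backward_traj T k \<circ> T (Suc k)"

definition closed_sup_ball :: "real \<Rightarrow> ('a \<Rightarrow> 'b::F_space) set" where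
  "closed_sup_ball r = {g \<in> bounded_maps. sup_dist g (\<lambda>_. 0) \<le> r}"

lemma bounded_maps_iff: "g \<in> bounded_maps \<longleftrightarrow> bounded (range g)"
proof
  assume "g \<in> bounded_maps"
  then show "bounded (range g)"
    unfolding bounded_maps_def bounded_def by (fastforce intro: less_imp_le)
next
  assume "bounded (range g)"
  then obtain a e where e: "\<And>x. dist a (g x) \<le> e"
    unfolding bounded_def by auto
  have "dist (g x1) (g x2) < 2 * e + 1" for x1 x2
    using dist_triangle3[of "g x1" "g x2" a] e[of x1] e[of x2] by linarith
  moreover have "0 < 2 * e + 1"
    using e[of undefined] zero_le_dist[of a "g undefined"] by linarith
  ultimately show "g \<in> bounded_maps"
    unfolding bounded_maps_def by blast
qed

lemma RB_op_apply:
  fixes f :: "'a \<Rightarrow> 'b::F_space"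
  assumes inj: "\<And>i. i \<in> {1..n} \<Longrightarrow> inj (l i)"
    and disj: "\<And>i j. i \<in> {1..n} \<Longrightarrow> j \<in> {1..n} \<Longrightarrow> i \<noteq> j \<Longrightarrow> range (l i) \<inter> range (l j) = {}"
    and i: "i \<in> {1..n}"
  shows "RB_op n l q S f (l i x) = q i x + S i x *\<^sub>R f x"
proof -
  have ind: "(indicator (range (l j)) (l i x) :: real) = (if j = i then 1 else 0)"
    if "j \<in> {1..n}" for j
    using disj[OF that i] by (auto simp: indicator_def)
  have *: "(\<Sum>j=1..n. indicator (range (l j)) (l i x) *\<^sub>R g j) = g i" for g :: "nat \<Rightarrow> 'b"
  proof -
    have "(\<Sum>j=1..n. indicator (range (l j)) (l i x) *\<^sub>R g j) = (\<Sum>j=1..n. if j = i then g j else 0)"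
      by (rule sum.cong) (use ind in auto)
    also have "\<dots> = g i"
      using i by simp
    finally show ?thesis .
  qed
  show ?thesis
    unfolding RB_op_def * by (simp add: inv_f_f[OF inj[OF i]])
qed

lemma RB_op_bounded_maps:
  fixes f :: "'a \<Rightarrow> 'b::F_space"
  assumes homogeneous: "\<And>c (y::'b) y'. dist (c *\<^sub>R y) (c *\<^sub>R y') = \<bar>c\<bar> * dist y y'"
    and inj: "\<And>i. i \<in> {1..n} \<Longrightarrow> inj (l i)"
    and cover: "(\<Union>i\<in>{1..n}. range (l i)) = UNIV"
    and disj: "\<And>i j. i \<in> {1..n} \<Longrightarrow> j \<in> {1..n} \<Longrightarrow> i \<noteq> j \<Longrightarrow> range (l i) \<inter> range (l j) = {}"
    and q: "\<And>i. i \<in> {1..n} \<Longrightarrow> q i \<in> bounded_maps"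
    and S: "\<And>i. i \<in> {1..n} \<Longrightarrow> S i \<in> bounded_maps"
    and f: "f \<in> bounded_maps"
  shows "RB_op n l q S f \<in> bounded_maps"
proof -
  obtain F where F: "\<And>x. dist 0 (f x) \<le> F"
    using f unfolding bounded_maps_iff bounded_any_center[of _ 0] by auto
  have "\<exists>C. \<forall>x. dist 0 (q i x + S i x *\<^sub>R f x) \<le> C" if i: "i \<in> {1..n}" for i
  proof -
    obtain Q where Q: "\<And>x. dist 0 (q i x) \<le> Q"
      using q[OF i] unfolding bounded_maps_iff bounded_any_center[of _ 0] by auto
    obtain K where K: "\<And>x. \<bar>S i x\<bar> \<le> K"
      using S[OF i] unfolding bounded_maps_iff bounded_any_center[of _ 0] by auto
    have "dist 0 (q i x + S i x *\<^sub>R f x) \<le> Q + K * F" for x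
    proof -
      have "dist 0 (q i x + S i x *\<^sub>R f x) \<le>
          dist 0 (S i x *\<^sub>R f x) + dist (0 + S i x *\<^sub>R f x) (q i x + S i x *\<^sub>R f x)"
        using dist_triangle by simp
      also have "\<dots> = \<bar>S i x\<bar> * dist 0 (f x) + dist 0 (q i x)"
        using homogeneous[of "S i x" 0 "f x"] dist_translation_invariant[of 0 _ "q i x"] by simp
      also have "\<dots> \<le> K * F + Q"
        by (intro add_mono mult_mono F K Q zero_le_dist)
          (use order_trans[OF abs_ge_zero K] in auto)
      finally show ?thesis by simp
    qed
    then show ?thesis by blast
  qed
  then obtain C where C: "\<And>i x. i \<in> {1..n} \<Longrightarrow> dist 0 (q i x + S i x *\<^sub>R f x) \<le> C i"
    by metis
  have "dist 0 (RB_op n l q S f y) \<le> Max (C ` {1..n})" for y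
  proof -
    obtain i x where i: "i \<in> {1..n}" and y: "y = l i x"
      using cover by blast
    have "dist 0 (RB_op n l q S f y) \<le> C i"
      using C[OF i, of x] RB_op_apply[of n l i q S f x] inj disj i y by simp
    also have "\<dots> \<le> Max (C ` {1..n})"
      using i by simp
    finally show ?thesis .
  qed
  then show ?thesis
    unfolding bounded_maps_iff bounded_def by blast
qed

end

theory Submission
  imports Defs
begin

text \<open>
  Each RB operator maps the ball of radius \<open>M / (1 - s)\<close> into itself, because
  \<open>M + s * (M / (1 - s)) = M / (1 - s)\<close>, and contracts the supremum metric by the common factor \<open>s\<close>.
  Since \<open>\<Psi>\<^sub>k\<^sub>+\<^sub>m f = \<Psi>\<^sub>k g\<close> for some \<open>g\<close> in the ball, all trajectories starting in the
  ball are within \<open>s\<^sup>k * 2M / (1 - s)\<close> of each other from time \<open>k\<close> on; hence they are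
  uniformly Cauchy with a common limit.
\<close>

section \<open>Supremum metric and its closed balls\<close>

lemma sup_dist_least: "(\<And>x. dist (f x) (g x) \<le> C) \<Longrightarrow> sup_dist f g \<le> C"
  unfolding sup_dist_def by (rule cSUP_least) auto

text \<open>Boundedness of both maps bounds the pointwise distances above, so the real
  \<open>SUP\<close> is a genuine supremum.\<close>

lemma dist_le_sup_dist:
  assumes "f \<in> bounded_maps" "g \<in> bounded_maps"
  shows "dist (f x) (g x) \<le> sup_dist f g"
  unfolding sup_dist_def
proof (rule cSUP_upper)
  obtain a c where "\<And>x. dist a (f x) \<le> c"
    using assms unfolding bounded_maps_iff bounded_def by auto
  moreover obtain d where "\<And>x. dist a (g x) \<le> d"
    using assms unfolding bounded_maps_iff bounded_any_center[of _ a] by auto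
  ultimately have "dist (f x) (g x) \<le> c + d" for x
    by (meson add_mono dist_triangle3 order_trans)
  then show "bdd_above (range (\<lambda>x. dist (f x) (g x)))"
    by (intro bdd_aboveI2)
qed simp

lemma abs_le_sup_norm:
  assumes "h \<in> bounded_maps"
  shows "\<bar>h x\<bar> \<le> sup_norm h"
proof -
  have "(\<lambda>_. 0 :: real) \<in> bounded_maps"
    unfolding bounded_maps_iff by simp
  from dist_le_sup_dist[OF assms this] show ?thesis
    by (simp add: sup_dist_def sup_norm_def)
qed

text \<open>A pointwise bound on the distance to 0 already forces membership in
  \<open>bounded_maps\<close>. The ball can thus be handled pointwise, without suprema.\<close>

lemma mem_closed_sup_ball_iff: "g \<in> closed_sup_ball r \<longleftrightarrow> (\<forall>x. dist (g x) 0 \<le> r)"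
proof
  assume g: "g \<in> closed_sup_ball r"
  have "(\<lambda>_. 0) \<in> bounded_maps"
    unfolding bounded_maps_iff by simp
  with g show "\<forall>x. dist (g x) 0 \<le> r"
    unfolding closed_sup_ball_def using dist_le_sup_dist[of g "\<lambda>_. 0"] order_trans by blast
next
  assume g: "\<forall>x. dist (g x) 0 \<le> r"
  then have "g \<in> bounded_maps"
    unfolding bounded_maps_iff bounded_any_center[of _ 0] by (auto simp: dist_commute)
  with g show "g \<in> closed_sup_ball r"
    unfolding closed_sup_ball_def by (auto intro: sup_dist_least)
qed

lemma sup_dist_zero_imp_eq:
  assumes "f \<in> bounded_maps" "g \<in> bounded_maps" "sup_dist f g \<le> 0"
  shows "f = g"
proof
  show "f x = g x" for x
    using dist_le_sup_dist[OF assms(1,2), of x] assms(3)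
    by (simp flip: dist_le_zero_iff)
qed

lemma sup_dist_triangle2:
  assumes "f \<in> bounded_maps" "g \<in> bounded_maps" "h \<in> bounded_maps"
  shows "sup_dist f g \<le> sup_dist h f + sup_dist h g"
proof (rule sup_dist_least)
  show "dist (f x) (g x) \<le> sup_dist h f + sup_dist h g" for x
    using dist_triangle3[of "f x" "g x" "h x"] dist_le_sup_dist[of h f x] dist_le_sup_dist[of h g x] assms
    by linarith
qed

text \<open>Recovers a real bound on each entry from a supremum over k taken in
  \<open>ereal\<close>, where it exists without a prior boundedness claim.\<close>

lemma SUP_Max_ereal_upper:
  assumes "(SUP k\<in>K. MAX i\<in>I k. ereal (a i k)) \<le> ereal c" "k \<in> K" "finite (I k)" "i \<in> I k"
  shows "a i k \<le> c"
proof -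
  have "ereal (a i k) \<le> (MAX i\<in>I k. ereal (a i k))"
    using assms(3,4) by (intro Max_ge) auto
  also have "\<dots> \<le> (SUP k\<in>K. MAX i\<in>I k. ereal (a i k))"
    using assms(2) by (rule SUP_upper)
  also note assms(1)
  finally show ?thesis by simp
qed

text \<open>Translation invariance stands in for a norm: pass through \<open>c + b\<close> and
  cancel the common summand on each leg.\<close>

lemma dist_add_add_le:
  fixes a b c d :: "'a::F_space"
  shows "dist (a + b) (c + d) \<le> dist a c + dist b d"
  using dist_triangle[of "a + b" "c + d" "c + b"] dist_translation_invariant[of a b c]
    dist_translation_invariant[of b c d] by (simp add: add.commute)

section \<open>Backward trajectories of uniformly contracting self-maps\<close>

lemma backward_traj_contracts:
  fixes T :: "nat \<Rightarrow> ('x \<Rightarrow> 'y::metric_space) \<Rightarrow> 'x \<Rightarrow> 'y"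
  assumes maps: "\<And>k f. k \<ge> 1 \<Longrightarrow> f \<in> A \<Longrightarrow> T k f \<in> A"
    and lip: "\<And>k f g C x. k \<ge> 1 \<Longrightarrow> f \<in> A \<Longrightarrow> g \<in> A \<Longrightarrow> (\<And>x. dist (f x) (g x) \<le> C)
      \<Longrightarrow> dist (T k f x) (T k g x) \<le> s * C"
    and fg: "f \<in> A" "g \<in> A" "\<And>x. dist (f x) (g x) \<le> C"
  shows "dist (backward_traj T k f x) (backward_traj T k g x) \<le> s ^ k * C"
  using fg
\<comment> \<open>The innermost map \<open>T (Suc k)\<close> is peeled off first. It replaces
  \<open>f\<close>, \<open>g\<close> by their images and \<open>C\<close> by \<open>s * C\<close>,
  hence the generalisation.\<close>
proof (induction k arbitrary: f g C)
  case 0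
  then show ?case by simp
next
  case (Suc k)
  then have "dist (backward_traj T k (T (Suc k) f) x) (backward_traj T k (T (Suc k) g) x)
      \<le> s ^ k * (s * C)"
    by (intro Suc.IH maps lip) auto
  then show ?case by (simp add: mult_ac)
qed

lemma backward_traj_mem:
  assumes "\<And>k f. k \<ge> 1 \<Longrightarrow> f \<in> A \<Longrightarrow> T k f \<in> A" "f \<in> A"
  shows "backward_traj T k f \<in> A"
  using assms(2) by (induction k arbitrary: f) (auto simp: assms(1))

text \<open>The witness is the image of \<open>f\<close> under the m inner maps with indices k+1 to
  k+m. Here the backward order matters: later maps act inside and leave the k outer maps
  unchanged.\<close>

lemma backward_traj_add:
  assumes "\<And>k f. k \<ge> 1 \<Longrightarrow> f \<in> A \<Longrightarrow> T k f \<in> A" "f \<in> A"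
  shows "\<exists>g\<in>A. backward_traj T (k + m) f = backward_traj T k g"
  using assms(2)
proof (induction m arbitrary: f)
  case 0
  then show ?case by auto
next
  case (Suc m)
  from Suc.IH[of "T (Suc (k + m)) f"] show ?case
    using assms(1)[of "Suc (k + m)" f] Suc.prems by simp
qed

text \<open>The limit \<open>h\<close> is built pointwise from the single start \<open>f0\<close>,
  using completeness of the codomain. The second conclusion is uniform in the start and in the
  point, so \<open>h\<close> attracts all of \<open>A\<close>. Since \<open>A\<close> is not assumed
  closed, \<open>h\<close> need not lie in it.\<close>

lemma backward_traj_uniform_limit:
  fixes T :: "nat \<Rightarrow> ('x \<Rightarrow> 'y::complete_space) \<Rightarrow> 'x \<Rightarrow> 'y"
  assumes maps: "\<And>k f. k \<ge> 1 \<Longrightarrow> f \<in> A \<Longrightarrow> T k f \<in> A"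
    and lip: "\<And>k f g C x. k \<ge> 1 \<Longrightarrow> f \<in> A \<Longrightarrow> g \<in> A \<Longrightarrow> (\<And>x. dist (f x) (g x) \<le> C)
      \<Longrightarrow> dist (T k f x) (T k g x) \<le> s * C"
    and s: "0 \<le> s" "s < 1"
    and diam: "\<And>f g x. f \<in> A \<Longrightarrow> g \<in> A \<Longrightarrow> dist (f x) (g x) \<le> D"
    and f0: "f0 \<in> A"
  obtains h where "\<And>x. (\<lambda>k. backward_traj T k f0 x) \<longlonglongrightarrow> h x"
    and "\<And>f k x. f \<in> A \<Longrightarrow> dist (backward_traj T k f x) (h x) \<le> s ^ k * D"
proof -
  have close: "dist (backward_traj T k f x) (backward_traj T (k + m) f0 x) \<le> s ^ k * D"
    if f: "f \<in> A" for f k m x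
  proof -
    obtain g where "g \<in> A" "backward_traj T (k + m) f0 = backward_traj T k g"
      using backward_traj_add[of A T f0 k m] maps f0 by blast
    then show ?thesis
      using backward_traj_contracts[of A T s f g D k x] maps lip diam f by simp
  qed
  have null: "(\<lambda>k. s ^ k * D) \<longlonglongrightarrow> 0"
    using s by (intro tendsto_mult_left_zero LIMSEQ_realpow_zero)
  have "Cauchy (\<lambda>k. backward_traj T k f0 x)" for x
    unfolding Cauchy_altdef
  proof (intro allI impI)
    fix e :: real
    assume "e > 0"
    with null obtain N where N: "\<And>k. k \<ge> N \<Longrightarrow> s ^ k * D < e"
      using order_tendstoD(2)[OF null] unfolding eventually_sequentially by blast
    have "dist (backward_traj T k f0 x) (backward_traj T m f0 x) < e" if "k \<ge> N" "m > k" for k m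
      using close[OF f0, of k x "m - k"] N[OF that(1)] that(2) by simp
    then show "\<exists>N. \<forall>k\<ge>N. \<forall>m>k. dist (backward_traj T k f0 x) (backward_traj T m f0 x) < e"
      by blast
  qed
  then have "\<exists>y. (\<lambda>k. backward_traj T k f0 x) \<longlonglongrightarrow> y" for x
    by (simp add: Cauchy_convergent_iff convergent_def)
  then obtain h where h: "\<And>x. (\<lambda>k. backward_traj T k f0 x) \<longlonglongrightarrow> h x"
    by metis
  \<comment> \<open>The bound in \<open>close\<close> does not depend on m, so it survives m tending
    to infinity with k fixed.\<close>
  have "dist (backward_traj T k f x) (h x) \<le> s ^ k * D" if "f \<in> A" for f k x
  proof (rule tendsto_upperbound)
    have "(\<lambda>m. backward_traj T (k + m) f0 x) \<longlonglongrightarrow> h x"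
      using LIMSEQ_ignore_initial_segment[OF h, of k x] by (simp add: add.commute)
    then show "(\<lambda>m. dist (backward_traj T k f x) (backward_traj T (k + m) f0 x))
        \<longlonglongrightarrow> dist (backward_traj T k f x) (h x)"
      by (intro tendsto_dist tendsto_const)
  qed (use close[OF that] in auto)
  with h that show thesis by blast
qed

section \<open>Application to Read-Bajraktarevic operators\<close>

theorem theorem5p1:
  fixes n :: "nat \<Rightarrow> nat"
    and l :: "nat \<Rightarrow> nat \<Rightarrow> 'x::complete_space \<Rightarrow> 'x"
    and q :: "nat \<Rightarrow> nat \<Rightarrow> 'x \<Rightarrow> 'y::F_space"
    and S :: "nat \<Rightarrow> nat \<Rightarrow> 'x \<Rightarrow> real"
    and T :: "nat \<Rightarrow> ('x \<Rightarrow> 'y) \<Rightarrow> 'x \<Rightarrow> 'y"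
    and s M :: real
  assumes homogeneous: "\<And>c (y::'y) y'. dist (c *\<^sub>R y) (c *\<^sub>R y') = \<bar>c\<bar> * dist y y'"
    and n_gt_1: "\<And>k. k \<ge> 1 \<Longrightarrow> n k > 1"
    and l_inj: "\<And>k i. k \<ge> 1 \<Longrightarrow> i \<in> {1..n k} \<Longrightarrow> inj (l i k)"
    and l_contraction: "\<And>k i. k \<ge> 1 \<Longrightarrow> i \<in> {1..n k} \<Longrightarrow> contraction (l i k)"
    and l_cover: "\<And>k. k \<ge> 1 \<Longrightarrow> (\<Union>i\<in>{1..n k}. range (l i k)) = UNIV"
    and l_disjoint: "\<And>k i j. k \<ge> 1 \<Longrightarrow> i \<in> {1..n k} \<Longrightarrow> j \<in> {1..n k} \<Longrightarrow> i \<noteq> j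
          \<Longrightarrow> range (l i k) \<inter> range (l j k) = {}"
    and q_bounded: "\<And>k i. k \<ge> 1 \<Longrightarrow> i \<in> {1..n k} \<Longrightarrow> q i k \<in> bounded_maps"
    and S_bounded: "\<And>k i. k \<ge> 1 \<Longrightarrow> i \<in> {1..n k} \<Longrightarrow> S i k \<in> bounded_maps"
    and T_def: "\<And>k. k \<ge> 1 \<Longrightarrow> T k = RB_op (n k) (\<lambda>i. l i k) (\<lambda>i. q i k) (\<lambda>i. S i k)"
    and s_def: "ereal s = (SUP k\<in>{1..}. MAX i\<in>{1..n k}. ereal (sup_norm (S i k)))"
    and s_less_1: "s < 1"
    and M_pos: "M > 0"
    and q_le_M: "(SUP k\<in>{1..}. MAX i\<in>{1..n k}. ereal (sup_dist (q i k) (\<lambda>_. 0))) \<le> ereal M"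
  shows "\<exists>!fstar. fstar \<in> closed_sup_ball (M / (1 - s)) \<and>
           (\<forall>f0 \<in> closed_sup_ball (M / (1 - s)).
              (\<lambda>k. sup_dist (backward_traj T k f0) fstar) \<longlonglongrightarrow> 0)"
proof -
  define R where "R = M / (1 - s)"
  define A where "A = (closed_sup_ball R :: ('x \<Rightarrow> 'y) set)"
  have A_iff: "f \<in> A \<longleftrightarrow> (\<forall>x. dist (f x) 0 \<le> R)" for f
    unfolding A_def by (rule mem_closed_sup_ball_iff)
  have bdd: "f \<in> bounded_maps" if "f \<in> A" for f
    using that unfolding A_def closed_sup_ball_def by simp
  have R_eq: "M + s * R = R" and R_pos: "R > 0"
    unfolding R_def using s_less_1 M_pos by (simp_all add: field_simps)
  have S_le: "\<bar>S i k x\<bar> \<le> s" if "k \<ge> 1" "i \<in> {1..n k}" for k i x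
  proof -
    have "sup_norm (S i k) \<le> s"
      by (rule SUP_Max_ereal_upper[where a = "\<lambda>i k. sup_norm (S i k)", OF eq_refl[OF s_def[symmetric]]])
        (use that in auto)
    with abs_le_sup_norm[OF S_bounded[OF that]] show ?thesis
      using order_trans by blast
  qed
  have q_le: "dist (q i k x) 0 \<le> M" if "k \<ge> 1" "i \<in> {1..n k}" for k i x
  proof -
    have "sup_dist (q i k) (\<lambda>_. 0) \<le> M"
      by (rule SUP_Max_ereal_upper[where a = "\<lambda>i k. sup_dist (q i k) (\<lambda>_. 0)", OF q_le_M])
        (use that in auto)
    then have "q i k \<in> closed_sup_ball M"
      using q_bounded[OF that] unfolding closed_sup_ball_def by simp
    then show ?thesis
      unfolding mem_closed_sup_ball_iff by blast
  qed
  \<comment> \<open>A single value of the scaling functions suffices: \<open>n 1 > 1\<close>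
    provides the index 1, and the point is arbitrary.\<close>
  have s_nonneg: "0 \<le> s"
    using S_le[of 1 1 undefined] n_gt_1[of 1] by (simp add: order_trans[OF abs_ge_zero])
  \<comment> \<open>The index and the preimage depend on k and y only. Quantifying over
    \<open>f\<close> innermost lets two functions be compared through the same branch.\<close>
  have cases: "\<exists>i\<in>{1..n k}. \<exists>x. \<forall>f. T k f y = q i k x + S i k x *\<^sub>R f x" if k: "k \<ge> 1" for k y
  proof -
    obtain i x where i: "i \<in> {1..n k}" and y: "y = l i k x"
      using l_cover[OF k] by blast
    have "T k f y = q i k x + S i k x *\<^sub>R f x" for f
      unfolding T_def[OF k] y
      by (rule RB_op_apply[where l = "\<lambda>i. l i k" and q = "\<lambda>i. q i k" and S = "\<lambda>i. S i k"])
        (use l_inj l_disjoint k i in auto)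
    with i show ?thesis by blast
  qed
  have lip: "dist (T k f y) (T k g y) \<le> s * C"
    if k: "k \<ge> 1" and le: "\<And>x. dist (f x) (g x) \<le> C" for k f g C y
  proof -
    obtain i x where i: "i \<in> {1..n k}" and T: "\<And>f. T k f y = q i k x + S i k x *\<^sub>R f x"
      using cases[OF k] by blast
    \<comment> \<open>The common summand \<open>q i k x\<close> contributes distance 0, and
      homogeneity pulls out the scalar.\<close>
    have "dist (T k f y) (T k g y) \<le> \<bar>S i k x\<bar> * dist (f x) (g x)"
      unfolding T using dist_add_add_le[of "q i k x" _ "q i k x"] by (simp add: homogeneous[symmetric])
    also have "\<dots> \<le> s * C"
      using S_le[OF k i] le s_nonneg by (intro mult_mono) auto
    finally show ?thesis .
  qed
  have maps: "T k f \<in> A" if k: "k \<ge> 1" and f: "f \<in> A" for k f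
    unfolding A_iff
  proof
    fix y
    obtain i x where i: "i \<in> {1..n k}" and T: "\<And>f. T k f y = q i k x + S i k x *\<^sub>R f x"
      using cases[OF k] by blast
    have "dist (T k f y) 0 \<le> dist (q i k x) 0 + \<bar>S i k x\<bar> * dist (f x) 0"
      unfolding T using dist_add_add_le[of "q i k x" "S i k x *\<^sub>R f x" 0 0]
        homogeneous[of "S i k x" "f x" 0] by simp
    also have "\<dots> \<le> M + s * R"
      using S_le[OF k i] q_le[OF k i] f s_nonneg unfolding A_iff by (intro add_mono mult_mono) auto
    finally show "dist (T k f y) 0 \<le> R"
      unfolding R_eq .
  qed
  have diam: "dist (f x) (g x) \<le> 2 * R" if "f \<in> A" "g \<in> A" for f g x
    using that dist_triangle2[of "f x" "g x" 0] unfolding A_iff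
    by (smt (verit, best))
  \<comment> \<open>The zero function is a concrete starting point: its trajectory defines the limit
    and later serves to test uniqueness.\<close>
  have zero: "(\<lambda>_. 0) \<in> A"
    unfolding A_iff using R_pos by simp
  obtain h where h: "\<And>x. (\<lambda>k. backward_traj T k (\<lambda>_. 0) x) \<longlonglongrightarrow> h x"
    and bound: "\<And>f k x. f \<in> A \<Longrightarrow> dist (backward_traj T k f x) (h x) \<le> s ^ k * (2 * R)"
    using backward_traj_uniform_limit[of A T s "2 * R" "\<lambda>_. 0"]
      maps lip s_nonneg s_less_1 diam zero by blast
  have mem: "backward_traj T k f \<in> A" if "f \<in> A" for k f
    using backward_traj_mem[of A T f k] maps that by blast
  \<comment> \<open>The ball is cut out by closed pointwise conditions, which pass to the pointwise
    limit.\<close>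
  have hA: "h \<in> A"
    unfolding A_iff
  proof
    fix x
    have "(\<lambda>k. dist (backward_traj T k (\<lambda>_. 0) x) 0) \<longlonglongrightarrow> dist (h x) 0"
      by (intro tendsto_dist h tendsto_const)
    then show "dist (h x) 0 \<le> R"
      by (rule tendsto_upperbound) (use mem[OF zero] in \<open>auto simp: A_iff\<close>)
  qed
  have sup_dist_nonneg: "0 \<le> sup_dist f g" if "f \<in> A" "g \<in> A" for f g
    using dist_le_sup_dist[of f g] bdd that zero_le_dist order_trans by blast
  \<comment> \<open>The bound is uniform in x, so it also bounds \<open>sup_dist\<close> and
    squeezes it to 0.\<close>
  have lim: "(\<lambda>k. sup_dist (backward_traj T k f) h) \<longlonglongrightarrow> 0" if f: "f \<in> A" for f
  proof (rule tendsto_sandwich[OF _ _ tendsto_const])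
    show "(\<lambda>k. s ^ k * (2 * R)) \<longlonglongrightarrow> 0"
      using s_nonneg s_less_1 by (intro tendsto_mult_left_zero LIMSEQ_realpow_zero)
  qed (use sup_dist_nonneg mem[OF f] hA bound[OF f] in \<open>auto intro!: always_eventually sup_dist_least\<close>)
  have "g = h" if g: "g \<in> A" and "\<forall>f\<in>A. (\<lambda>k. sup_dist (backward_traj T k f) g) \<longlonglongrightarrow> 0" for g
  proof (rule sup_dist_zero_imp_eq)
    let ?\<Psi> = "\<lambda>k. backward_traj T k (\<lambda>_. 0)"
    have "(\<lambda>k. sup_dist (?\<Psi> k) g + sup_dist (?\<Psi> k) h) \<longlonglongrightarrow> 0 + 0"
      using that(2) zero lim by (intro tendsto_add) auto
    \<comment> \<open>The constant \<open>sup_dist g h\<close> lies below every term of a null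
      sequence, by the triangle inequality through the zero trajectory.\<close>
    then have "sup_dist g h \<le> 0 + 0"
      by (rule tendsto_lowerbound)
        (use bdd mem[OF zero] g hA in \<open>auto intro!: always_eventually sup_dist_triangle2\<close>)
    then show "sup_dist g h \<le> 0" by simp
  qed (use bdd g hA in auto)
  with hA lim show ?thesis
    unfolding A_def[symmetric] R_def[symmetric] by blast
qed

end
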